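(* Let $d>1$ be an odd integer and let $f\in\mathcal{H}(2,d)$ be sharp. Then at least one monomial of degree $d-1$ has a nonzero coefficient in $f$.
   Context: $\mathcal{H}(2,d)$ denotes the set of real polynomials $p(x,y)$ of degree exactly $d$ with nonnegative coefficients such that $p(x,y)=1$ whenever $x+y=1$. For a polynomial $p$, $N(p)$ is the number of distinct monomials with nonzero coefficient in $p$. A polynomial $p\in\mathcal{H}(2,d)$ is called sharp if $N(p)$ is minimal among all elements of $\mathcal{H}(2,d)$. *)

theory Defs
  imports Complex_Main "HOL-Computational_Algebra.Polynomial"
begin

text \<open>
  The polynomial ring in the two variables x and y over the reals is the type \<open>real poly poly\<close>:
  the inner indeterminate is x and the outer one is y, so the coefficient of x^a y^b in p is
  \<open>coeff (coeff p b) a\<close>.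
\<close>

definition coeff2 :: "'a::zero poly poly \<Rightarrow> nat \<Rightarrow> nat \<Rightarrow> 'a" where
  "coeff2 p a b = coeff (coeff p b) a"

definition eval2 :: "'a::comm_semiring_1 poly poly \<Rightarrow> 'a \<Rightarrow> 'a \<Rightarrow> 'a" where
  "eval2 p x y = poly (poly p [:y:]) x"

text \<open>The exponent pair (a, b) stands for the monomial x^a y^b.\<close>

definition monomials2 :: "'a::zero poly poly \<Rightarrow> (nat \<times> nat) set" where
  "monomials2 p = {(a, b). coeff2 p a b \<noteq> 0}"

definition num_monomials :: "'a::zero poly poly \<Rightarrow> nat" where
  "num_monomials p = card (monomials2 p)"

text \<open>The zero polynomial is given total degree 0, as in the library's \<open>degree\<close>.\<close>

definition total_degree :: "'a::zero poly poly \<Rightarrow> nat" where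
  "total_degree p = (if p = 0 then 0 else Max ((\<lambda>(a, b). a + b) ` monomials2 p))"

lemma monomials2_eq_Sigma:
  "monomials2 p = prod.swap ` (SIGMA b:{..degree p}. {a. a \<le> degree (coeff p b) \<and> coeff (coeff p b) a \<noteq> 0})"
proof -
  have "b \<le> degree p \<and> a \<le> degree (coeff p b)" if "coeff (coeff p b) a \<noteq> 0" for a b
    using that by (metis coeff_0 le_degree)
  then show ?thesis
    by (force simp: monomials2_def coeff2_def)
qed

lemma finite_monomials2 [simp]: "finite (monomials2 p)"
  unfolding monomials2_eq_Sigma by (intro finite_imageI finite_SigmaI) auto

lemma eval2_eq_sum_monomials2:
  "eval2 p x y = (\<Sum>(a, b)\<in>monomials2 p. coeff2 p a b * x ^ a * y ^ b)"
proof -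
  let ?S = "\<lambda>b. {a. a \<le> degree (coeff p b) \<and> coeff (coeff p b) a \<noteq> 0}"
  have "eval2 p x y = (\<Sum>b\<le>degree p. poly (coeff p b) x * y ^ b)"
    by (simp add: eval2_def poly_altdef [of p] poly_sum poly_power)
  also have "\<dots> = (\<Sum>b\<le>degree p. \<Sum>a\<in>?S b. coeff (coeff p b) a * x ^ a * y ^ b)"
  proof (rule sum.cong [OF refl])
    fix b
    have "poly (coeff p b) x = (\<Sum>a\<in>?S b. coeff (coeff p b) a * x ^ a)"
      unfolding poly_altdef by (rule sum.mono_neutral_right) auto
    then show "poly (coeff p b) x * y ^ b = (\<Sum>a\<in>?S b. coeff (coeff p b) a * x ^ a * y ^ b)"
      by (simp add: sum_distrib_right)
  qed
  also have "\<dots> = (\<Sum>(b, a)\<in>(SIGMA b:{..degree p}. ?S b). coeff (coeff p b) a * x ^ a * y ^ b)"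
    by (rule sum.Sigma) auto
  also have "\<dots> = (\<Sum>(a, b)\<in>monomials2 p. coeff2 p a b * x ^ a * y ^ b)"
    unfolding monomials2_eq_Sigma
    by (subst sum.reindex) (auto simp: coeff2_def intro!: sum.cong)
  finally show ?thesis .
qed

definition H2 :: "nat \<Rightarrow> real poly poly set" where
  "H2 d = {p. total_degree p = d \<and> (\<forall>a b. coeff2 p a b \<ge> 0) \<and>
              (\<forall>x y. x + y = 1 \<longrightarrow> eval2 p x y = 1)}"

definition sharp :: "nat \<Rightarrow> real poly poly \<Rightarrow> bool" where
  "sharp d p \<longleftrightarrow> p \<in> H2 d \<and> (\<forall>q\<in>H2 d. num_monomials p \<le> num_monomials q)"

end

theory Submission
  imports Defs
begin

text \<open>
  Write \<open>1 - f = (1 - x - y) q\<close> and give every coefficient of \<open>q\<close> a sign. Nonnegativity of \<open>f\<close> says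
  that a positive entry of \<open>q\<close> never has two negative neighbours one degree below, and that a
  negative entry above two positive ones (a sink) yields a monomial of \<open>f\<close>. Hence the number of
  descents from positive to negative along a row grows only where there are sinks, while in the top
  row, of degree \<open>d - 1\<close>, no two adjacent entries are negative and each adjacent positive pair yields
  a monomial of degree \<open>d\<close>. With the two pure powers of \<open>x\<close> and \<open>y\<close>, this gives at least
  \<open>d + 1 - r\<close> monomials, where \<open>r \<le> (d - 1) div 2\<close> is the number of descents in the top row. If \<open>f\<close> has
  no monomial of degree \<open>d - 1\<close>, then \<open>r\<close> is also at most the number of descents in the row below,
  so \<open>r \<le> (d - 3) div 2\<close> for odd \<open>d\<close>, and \<open>f\<close> has at least \<open>(d + 5) div 2\<close> monomials. An explicit
  family has only \<open>(d + 3) div 2\<close>.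
\<close>

section \<open>A polynomial with few monomials\<close>

text \<open>The power sums of the roots 1 and \<open>- y\<close> of \<open>t\<^sup>2 - x t - y\<close> when \<open>x + y = 1\<close>.\<close>

fun power_sum :: "nat \<Rightarrow> real poly poly" where
  "power_sum 0 = [:[:2:]:]"
| "power_sum (Suc 0) = [:[:0, 1:]:]"
| "power_sum (Suc (Suc n)) = smult [:0, 1:] (power_sum (Suc n)) + pCons 0 (power_sum n)"

lemma eval2_power_sum: "x + y = 1 \<Longrightarrow> eval2 (power_sum n) x y = 1 + (- y) ^ n"
proof (induction n rule: power_sum.induct)
  case (3 n)
  have "eval2 (power_sum (Suc (Suc n))) x y
      = x * eval2 (power_sum (Suc n)) x y + y * eval2 (power_sum n) x y"
    by (simp add: eval2_def)
  also have "\<dots> = (1 - y) * (1 + (- y) ^ Suc n) + y * (1 + (- y) ^ n)"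
    using 3 by (simp add: eq_diff_eq [symmetric])
  also have "\<dots> = 1 + (- y) ^ Suc (Suc n)"
    by (simp add: algebra_simps)
  finally show ?case .
qed (auto simp: eval2_def)

lemma coeff2_power_sum_nonneg: "coeff2 (power_sum n) a b \<ge> 0"
  by (induction n arbitrary: a b rule: power_sum.induct)
    (auto simp: coeff2_def coeff_pCons split: nat.splits)

text \<open>Give x weight 1 and y weight 2: the recurrence keeps \<open>power_sum n\<close>
  homogeneous of weight \<open>n\<close>.\<close>

lemma coeff2_power_sum_eq_0: "a + 2 * b \<noteq> n \<Longrightarrow> coeff2 (power_sum n) a b = 0"
  by (induction n arbitrary: a b rule: power_sum.induct)
    (auto simp: coeff2_def coeff_pCons split: nat.splits)

text \<open>On x + y = 1 and for odd \<open>d\<close>, adding y^d cancels the term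
  \<open>(- y) ^ d\<close> of the power sum, which by weight has at most \<open>d div 2 + 1\<close>
  monomials.\<close>

lemma exists_H2_few_monomials:
  assumes "odd d"
  shows "\<exists>p\<in>H2 d. 2 * num_monomials p \<le> d + 3"
proof
  define p where "p = power_sum d + monom 1 d"
  have y: "coeff2 (monom 1 d :: real poly poly) a b = (if a = 0 \<and> b = d then 1 else 0)" for a b
    by (auto simp: coeff2_def)
  have c: "coeff2 p a b = coeff2 (power_sum d) a b + (if a = 0 \<and> b = d then 1 else 0)" for a b
    unfolding y [symmetric] by (simp add: p_def coeff2_def)
  have nonneg: "coeff2 p a b \<ge> 0" for a b
    unfolding c by (simp add: coeff2_power_sum_nonneg)
  have sub: "monomials2 p \<subseteq> insert (0, d) ((\<lambda>b. (d - 2 * b, b)) ` {..d div 2})"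
  proof (rule subrelI)
    fix a b
    assume "(a, b) \<in> monomials2 p"
    then have "coeff2 (power_sum d) a b \<noteq> 0 \<or> a = 0 \<and> b = d"
      by (auto simp: monomials2_def c split: if_splits)
    then have "a + 2 * b = d \<or> a = 0 \<and> b = d"
      using coeff2_power_sum_eq_0 by blast
    then show "(a, b) \<in> insert (0, d) ((\<lambda>b. (d - 2 * b, b)) ` {..d div 2})"
      by (auto intro!: image_eqI [of _ _ b])
  qed
  have "coeff2 p 0 d > 0"
    unfolding c using coeff2_power_sum_nonneg [of d 0 d] by simp
  then have top: "(0, d) \<in> monomials2 p"
    by (simp add: monomials2_def)
  then have "p \<noteq> 0"
    by (auto simp: monomials2_def coeff2_def)
  moreover have "Max ((\<lambda>(a, b). a + b) ` monomials2 p) = d"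
  proof (rule Max_eqI)
    show "n \<le> d" if "n \<in> (\<lambda>(a, b). a + b) ` monomials2 p" for n
      using that sub by fastforce
    show "d \<in> (\<lambda>(a, b). a + b) ` monomials2 p"
      using top by force
  qed simp
  ultimately have "total_degree p = d"
    by (simp add: total_degree_def)
  moreover have "eval2 p x y = 1" if "x + y = 1" for x y
  proof -
    have "eval2 p x y = eval2 (power_sum d) x y + y ^ d"
      by (simp add: p_def eval2_def poly_monom poly_power)
    then show ?thesis
      using that assms by (simp add: eval2_power_sum)
  qed
  ultimately show "p \<in> H2 d"
    using nonneg by (simp add: H2_def)
  have "num_monomials p \<le> Suc (card ((\<lambda>b. (d - 2 * b, b)) ` {..d div 2}))"
    unfolding num_monomials_def
    by (rule order.trans [OF card_mono [OF _ sub]]) (auto intro: card_insert_le_m1 simp: card_insert_if)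
  also have "\<dots> \<le> Suc (Suc (d div 2))"
    using card_image_le [of "{..d div 2}" "\<lambda>b. (d - 2 * b, b)"] by simp
  finally show "2 * num_monomials p \<le> d + 3"
    using assms by (auto elim!: oddE)
qed

section \<open>Descents in triangles of signs\<close>

definition descents :: "nat \<Rightarrow> (nat \<Rightarrow> bool) \<Rightarrow> nat set" where
  "descents n U = {i. i < n \<and> U i \<and> \<not> U (Suc i)}"

definition sinks :: "nat \<Rightarrow> (nat \<Rightarrow> bool) \<Rightarrow> (nat \<Rightarrow> bool) \<Rightarrow> nat set" where
  "sinks n U V = {i. i < n \<and> U i \<and> U (Suc i) \<and> \<not> V (Suc i)}"

lemma finite_descents [simp]: "finite (descents n U)"
  by (simp add: descents_def)

lemma finite_sinks [simp]: "finite (sinks n U V)"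
  by (simp add: sinks_def)

lemma card_less_Suc_Collect:
  "card {i. i < Suc n \<and> P i} = card {i. i < n \<and> P i} + of_bool (P n)"
proof -
  have "{i. i < Suc n \<and> P i} = (if P n then insert n {i. i < n \<and> P i} else {i. i < n \<and> P i})"
    by (auto simp: less_Suc_eq)
  then show ?thesis by simp
qed

text \<open>The indicator term records a descent of \<open>U\<close> that has not yet been matched by one of \<open>V\<close>;
  it makes the induction go through.\<close>

lemma card_descents_le:
  assumes "U 0" and "\<And>i. i < n \<Longrightarrow> V (Suc i) \<Longrightarrow> U i \<or> U (Suc i)"
  shows "card (descents n V) + of_bool (\<not> U n \<and> V n) \<le> card (descents n U) + card (sinks n U V)"
  using assms(2)
proof (induction n)
  case 0
  then show ?case using assms(1) by (simp add: descents_def sinks_def)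
next
  case (Suc n)
  have "card (descents n V) + of_bool (\<not> U n \<and> V n) \<le> card (descents n U) + card (sinks n U V)"
    using Suc by simp
  moreover have "V (Suc n) \<Longrightarrow> U n \<or> U (Suc n)"
    using Suc.prems by simp
  ultimately show ?case
    unfolding descents_def sinks_def card_less_Suc_Collect
    by (auto simp: of_bool_def split: if_splits)
qed

text \<open>As \<open>U n\<close> holds, a descent and its successor both lie below
  \<open>n\<close>, and the successor is never itself a descent.\<close>

lemma double_card_descents_le:
  assumes "U n"
  shows "2 * card (descents n U) \<le> n"
proof -
  have "Suc i < n" if "i \<in> descents n U" for i
    using that assms by (metis (mono_tags, lifting) Suc_lessI descents_def mem_Collect_eq)
  then have "descents n U \<union> Suc ` descents n U \<subseteq> {..<n}"
    by (auto simp: descents_def)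
  then have "card (descents n U \<union> Suc ` descents n U) \<le> n"
    using card_mono [of "{..<n}"] by fastforce
  moreover have "descents n U \<inter> Suc ` descents n U = {}"
    by (auto simp: descents_def)
  ultimately show ?thesis
    by (simp add: card_Un_disjoint card_image)
qed

text \<open>An index that starts no positive pair is a descent or the successor of one.\<close>

lemma card_adjacent_pairs_ge:
  assumes "U 0" and "\<And>i. i < n \<Longrightarrow> U i \<or> U (Suc i)"
  shows "n \<le> card {i. i < n \<and> U i \<and> U (Suc i)} + 2 * card (descents n U)"
proof -
  have "{..<n} \<subseteq> {i. i < n \<and> U i \<and> U (Suc i)} \<union> (descents n U \<union> Suc ` descents n U)"
  proof
    fix i
    assume i: "i \<in> {..<n}"
    show "i \<in> {i. i < n \<and> U i \<and> U (Suc i)} \<union> (descents n U \<union> Suc ` descents n U)"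
    proof (cases "U i")
      case True
      with i show ?thesis by (auto simp: descents_def)
    next
      case False
      with assms(1) obtain j where j: "i = Suc j" by (cases i) auto
      with False i assms(2) [of j] have "j \<in> descents n U" by (auto simp: descents_def)
      with j show ?thesis by auto
    qed
  qed
  then have "n \<le> card ({i. i < n \<and> U i \<and> U (Suc i)} \<union> (descents n U \<union> Suc ` descents n U))"
    using card_mono [of "{i. i < n \<and> U i \<and> U (Suc i)} \<union> (descents n U \<union> Suc ` descents n U)" "{..<n}"]
    by simp
  also have "\<dots> \<le> card {i. i < n \<and> U i \<and> U (Suc i)} + (card (descents n U) + card (Suc ` descents n U))"
    using card_Un_le order.trans add_left_mono by meson
  finally show ?thesis by (simp add: card_image)
qed

lemma triangle_sinks_ge:
  fixes L :: "nat \<Rightarrow> nat \<Rightarrow> bool"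
  assumes left: "\<And>k. k \<le> m \<Longrightarrow> L k 0" and right: "\<And>k. k \<le> m \<Longrightarrow> L k k"
    and step: "\<And>k i. k < m \<Longrightarrow> i < k \<Longrightarrow> L (Suc k) (Suc i) \<Longrightarrow> L k i \<or> L k (Suc i)"
    and top: "\<And>i. i < m \<Longrightarrow> L m i \<or> L m (Suc i)"
    and "m > 0" and "even m" and no_sink: "sinks (m - 1) (L (m - 1)) (L m) = {}"
  shows "m + 2 \<le> 2 * ((\<Sum>k<m. card (sinks k (L k) (L (Suc k)))) + card {i. i < m \<and> L m i \<and> L m (Suc i)})"
proof -
  have row: "card (descents (Suc k) (L (Suc k))) \<le> card (descents k (L k)) + card (sinks k (L k) (L (Suc k)))"
    if "k < m" for k
  proof -
    \<comment> \<open>Row \<open>Suc k\<close> ends in a positive sign, so \<open>k\<close> is no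
      descent and both rows can be compared on length \<open>k\<close>.\<close>
    have "descents (Suc k) (L (Suc k)) = descents k (L (Suc k))"
      using right [of "Suc k"] that by (auto simp: descents_def less_Suc_eq)
    then show ?thesis
      using card_descents_le [of "L k" k "L (Suc k)"] left [of k] step [of k] that by simp
  qed
  have "card (descents n (L n)) \<le> (\<Sum>k<n. card (sinks k (L k) (L (Suc k))))" if "n \<le> m" for n
    using that
  proof (induction n)
    case 0
    then show ?case by (simp add: descents_def)
  next
    case (Suc n)
    then show ?case using row [of n] by simp
  qed
  then have "card (descents m (L m)) \<le> (\<Sum>k<m. card (sinks k (L k) (L (Suc k))))"
    by simp
  moreover have "m \<le> card {i. i < m \<and> L m i \<and> L m (Suc i)} + 2 * card (descents m (L m))"
    using card_adjacent_pairs_ge top left by blast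
  moreover have "2 * card (descents m (L m)) + 2 \<le> m"
  proof -
    have "card (descents m (L m)) \<le> card (descents (m - 1) (L (m - 1)))"
      using row [of "m - 1"] no_sink \<open>m > 0\<close> by simp
    moreover have "2 * card (descents (m - 1) (L (m - 1))) \<le> m - 1"
      using double_card_descents_le right by simp
    \<comment> \<open>The left side is even and \<open>m - 1\<close> is odd, so the bound sharpens
      to \<open>m - 2\<close>.\<close>
    ultimately show ?thesis
      using \<open>even m\<close> \<open>m > 0\<close> by presburger
  qed
  ultimately show ?thesis by simp
qed


section \<open>Nonnegative coefficients and the sign triangle\<close>

text \<open>If \<open>q k a\<close> is the coefficient of \<open>x^a y^(k - a)\<close> in \<open>(1 - f) / (1 - x - y)\<close>, then the
  coefficients \<open>c\<close> of \<open>f\<close> satisfy the recurrences below.\<close>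

lemma card_support_ge:
  fixes q c :: "nat \<Rightarrow> nat \<Rightarrow> real"
  assumes c_nonneg: "\<And>a b. c a b \<ge> 0"
    and q_0: "\<And>k. q (Suc k) 0 = q k 0 - c 0 (Suc k)"
    and q_Suc: "\<And>k i. i \<le> k \<Longrightarrow> q (Suc k) (Suc i) = q k i + q k (Suc i) - c (Suc i) (k - i)"
    and q_out: "\<And>k. q k (Suc k) = 0"
    and q_d: "\<And>i. q d i = 0"
    and "odd d" and "d > 1"
    and top: "\<exists>a\<le>d. c a (d - a) \<noteq> 0"
    and gap: "\<And>a b. a + b = d - 1 \<Longrightarrow> c a b = 0"
    and finite: "finite {(a, b). c a b \<noteq> 0}"
  shows "d + 5 \<le> 2 * card {(a, b). c a b \<noteq> 0}"
proof -
  define m where "m = d - 1"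
  have d: "d = Suc m" and "even m" and "m > 0"
    using \<open>odd d\<close> \<open>d > 1\<close> by (auto simp: m_def)
  \<comment> \<open>A positive sum of two parents has a positive parent; starting from a monomial of
    degree \<open>d\<close>, this puts a positive entry in every row up to \<open>m\<close>.\<close>
  have descend: "\<exists>i\<le>k. q k i > 0" if "a \<le> Suc k" "q (Suc k) a + c a (Suc k - a) > 0" for k a
  proof (cases a)
    case 0
    with that show ?thesis by (auto simp: q_0 intro!: exI [of _ 0])
  next
    case (Suc i)
    with that have i: "i \<le> k" and "q k i + q k (Suc i) > 0"
      by (auto simp: q_Suc)
    then have "q k i > 0 \<or> q k (Suc i) > 0"
      by linarith
    moreover have "q k (Suc i) > 0 \<Longrightarrow> Suc i \<le> k"
      using i q_out [of k] by (cases "i = k") auto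
    ultimately show ?thesis
      using i by blast
  qed
  have "\<exists>i\<le>k. q k i > 0" if "k \<le> m" for k
    using that
  proof (induction k rule: inc_induct)
    case base
    from top obtain a where "a \<le> d" "c a (d - a) > 0"
      using c_nonneg by (metis less_eq_real_def)
    then show ?case
      using descend [of a m] q_d [of a] by (simp add: d)
  next
    case (step k)
    then obtain a where "a \<le> Suc k" "q (Suc k) a > 0"
      by blast
    then show ?case
      using descend [of a k] c_nonneg [of a "Suc k - a"] by simp
  qed
  then obtain p where p: "\<And>k. k \<le> m \<Longrightarrow> p k \<le> k" "\<And>k. k \<le> m \<Longrightarrow> q k (p k) > 0"
    by metis
  have q_diag: "q (Suc k) (Suc k) = q k k - c (Suc k) 0" for k
    using q_Suc [of k k] q_out [of k] by simp
  have left_nonneg: "q k 0 \<ge> 0" if "k \<le> d" for k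
    using that
  proof (induction k rule: inc_induct)
    case (step k)
    then show ?case using q_0 [of k] c_nonneg [of 0 "Suc k"] by linarith
  qed (simp add: q_d)
  have right_nonneg: "q k k \<ge> 0" if "k \<le> d" for k
    using that
  proof (induction k rule: inc_induct)
    case (step k)
    then show ?case using q_diag [of k] c_nonneg [of "Suc k" 0] by linarith
  qed (simp add: q_d)

  text \<open>Zeros get alternating signs on either side of a positive entry, so that two adjacent zeros
    never have the same sign, while both ends of each row remain positive.\<close>
  define L where "L k i \<longleftrightarrow> q k i > 0 \<or> q k i = 0 \<and> (if i < p k then even i else even (k - i))"
    for k i
  have L_D: "q k i \<ge> 0" if "L k i" for k i
    using that by (auto simp: L_def)
  have not_L_D: "q k i \<le> 0" if "\<not> L k i" for k i
    using that by (auto simp: L_def not_less)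
  have zeros: "L k i \<noteq> L k (Suc i)" if "k \<le> m" "i < k" "q k i = 0" "q k (Suc i) = 0" for k i
  proof -
    \<comment> \<open>Both zeros lie on the same side of the positive entry at \<open>p k\<close>,
      where signs of zeros alternate.\<close>
    have "p k \<noteq> i" "p k \<noteq> Suc i"
      using p [OF \<open>k \<le> m\<close>] that by auto
    moreover have "even (k - i) \<longleftrightarrow> odd (k - Suc i)"
      using \<open>i < k\<close> by (metis Suc_diff_Suc even_Suc)
    ultimately show ?thesis
      using that by (auto simp: L_def)
  qed
  have pos_pos: "q k i + q k (Suc i) > 0" if "k \<le> m" "i < k" "L k i" "L k (Suc i)" for k i
    using zeros [of k i] L_D [of k i] L_D [of k "Suc i"] that by fastforce
  have neg_neg: "q k i + q k (Suc i) < 0" if "k \<le> m" "i < k" "\<not> L k i" "\<not> L k (Suc i)" for k i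
    using zeros [of k i] not_L_D [of k i] not_L_D [of k "Suc i"] that by fastforce
  have sink: "c (Suc i) (k - i) \<noteq> 0" if "k < m" "i \<in> sinks k (L k) (L (Suc k))" for k i
    using that pos_pos [of k i] not_L_D [of "Suc k" "Suc i"] q_Suc [of i k]
    by (auto simp: sinks_def)

  \<comment> \<open>Each element of \<open>W k\<close> yields a mixed monomial of degree
    \<open>k + 1\<close>: from a sink if \<open>k < m\<close>, from a positive pair above the zero
    row \<open>d\<close> if \<open>k = m\<close>.\<close>
  define W where "W k = (if k < m then sinks k (L k) (L (Suc k)) else {i. i < k \<and> L k i \<and> L k (Suc i)})"
    for k
  have W_less: "i < k" if "i \<in> W k" for i k
    using that by (auto simp: W_def sinks_def split: if_splits)
  have W_c: "c (Suc i) (k - i) \<noteq> 0" if "k \<le> m" "i \<in> W k" for k i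
  proof (cases "k < m")
    case True
    with that sink show ?thesis by (simp add: W_def)
  next
    case False
    with that have "i < m" "k = m" "L m i" "L m (Suc i)"
      by (auto simp: W_def)
    then show ?thesis
      using pos_pos [of m i] q_Suc [of i m] q_d [of "Suc i"] by (simp add: d)
  qed

  have "m + 2 \<le> 2 * ((\<Sum>k<m. card (sinks k (L k) (L (Suc k)))) + card {i. i < m \<and> L m i \<and> L m (Suc i)})"
  proof (rule triangle_sinks_ge)
    show "L k 0" if "k \<le> m" for k
      using left_nonneg [of k] p [OF that] that by (cases "p k = 0") (auto simp: L_def d)
    show "L k k" if "k \<le> m" for k
      using right_nonneg [of k] p [OF that] that by (auto simp: L_def d)
    show "L k i \<or> L k (Suc i)" if "k < m" "i < k" "L (Suc k) (Suc i)" for k i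
      using neg_neg [of k i] L_D [OF that(3)] c_nonneg [of "Suc i" "k - i"] q_Suc [of i k] that
      by fastforce
    show "L m i \<or> L m (Suc i)" if "i < m" for i
      using neg_neg [of m i] q_d [of "Suc i"] c_nonneg [of "Suc i" "m - i"] q_Suc [of i m] that
      by (fastforce simp: d)
    \<comment> \<open>A sink here would give a monomial of degree \<open>d - 1\<close>.\<close>
    have "c (Suc i) (m - 1 - i) = 0" if "i < m - 1" for i
      using that by (intro gap) (simp add: m_def)
    then show "sinks (m - 1) (L (m - 1)) (L m) = {}"
      using sink [of "m - 1"] \<open>m > 0\<close> by (auto simp: sinks_def)
  qed fact+
  also have "(\<Sum>k<m. card (sinks k (L k) (L (Suc k)))) + card {i. i < m \<and> L m i \<and> L m (Suc i)}
      = (\<Sum>k\<le>m. card (W k))"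
    by (simp add: W_def lessThan_Suc_atMost [symmetric])
  also have "\<dots> = card (SIGMA k:{..m}. W k)"
    by (rule card_SigmaI [symmetric]) (auto simp: W_def)
  also have "\<dots> = card ((\<lambda>(k, i). (Suc i, k - i)) ` (SIGMA k:{..m}. W k))" (is "_ = card ?I")
    by (rule card_image [symmetric]) (auto simp: inj_on_def dest!: W_less)
  finally have card_I: "m + 2 \<le> 2 * card ?I" .

  have q00: "q 0 0 > 0"
    using p [of 0] by simp
  \<comment> \<open>Without a pure power of x the right edge would stay at \<open>q 0 0 > 0\<close>
    and never reach zero in row \<open>d\<close>; the left edge does the same for y. Exponents in
    \<open>?I\<close> are both positive, so these two monomials are new.\<close>
  obtain A where A: "c (Suc A) 0 \<noteq> 0"
  proof (rule ccontr)
    assume "\<not> thesis"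
    then have "c (Suc k) 0 = 0" for k
      using that by blast
    then have "q k k = q 0 0" for k
      by (induction k) (simp_all add: q_diag)
    with q00 q_d show False by (metis less_irrefl)
  qed
  obtain B where B: "c 0 (Suc B) \<noteq> 0"
  proof (rule ccontr)
    assume "\<not> thesis"
    then have "c 0 (Suc k) = 0" for k
      using that by blast
    then have "q k 0 = q 0 0" for k
      by (induction k) (simp_all add: q_0)
    with q00 q_d show False by (metis less_irrefl)
  qed
  have "finite ?I"
    by (auto simp: W_def)
  moreover have "(0, Suc B) \<notin> ?I" "(Suc A, 0) \<notin> ?I"
    by (auto dest: W_less)
  ultimately have "card (insert (0, Suc B) (insert (Suc A, 0) ?I)) = card ?I + 2"
    by simp
  moreover have "card (insert (0, Suc B) (insert (Suc A, 0) ?I)) \<le> card {(a, b). c a b \<noteq> 0}"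
    using A B W_c by (intro card_mono finite) auto
  ultimately show ?thesis
    using card_I unfolding d by linarith
qed

section \<open>Homogeneous parts and exact division by 1 - x - y\<close>

text \<open>The form of degree \<open>k\<close> in \<open>p\<close>, dehomogenised at \<open>y = 1\<close>.\<close>

definition form :: "real poly poly \<Rightarrow> nat \<Rightarrow> real poly" where
  "form p k = (\<Sum>a\<le>k. monom (coeff2 p a (k - a)) a)"

text \<open>The forms of \<open>(1 - p) / (1 - x - y)\<close>, dehomogenised in the same way.\<close>

fun quotient_form :: "real poly poly \<Rightarrow> nat \<Rightarrow> real poly" where
  "quotient_form p 0 = 1 - form p 0"
| "quotient_form p (Suc k) = [:1, 1:] * quotient_form p k - form p (Suc k)"

lemma coeff_form: "coeff (form p k) i = (if i \<le> k then coeff2 p i (k - i) else 0)"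
  by (simp add: form_def coeff_sum if_distrib sum.delta' cong: if_cong)

lemma coeff_quotient_form_eq_0: "k < i \<Longrightarrow> coeff (quotient_form p k) i = 0"
  by (induction k arbitrary: i) (auto simp: coeff_form coeff_pCons split: nat.splits)

lemma poly_quotient_form:
  assumes "t \<ge> 0"
  shows "poly (quotient_form p k) t = (1 + t) ^ k * (1 - (\<Sum>j\<le>k. poly (form p j) t / (1 + t) ^ j))"
proof (induction k)
  case 0
  then show ?case by simp
next
  case (Suc k)
  have "(1 + t) ^ Suc k \<noteq> 0"
    using assms by simp
  then have "(1 + t) ^ Suc k * (poly (form p (Suc k)) t / (1 + t) ^ Suc k) = poly (form p (Suc k)) t"
    by simp
  moreover have "poly (quotient_form p (Suc k)) t
      = (1 + t) * poly (quotient_form p k) t - poly (form p (Suc k)) t"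
    by (simp add: algebra_simps)
  ultimately show ?case
    unfolding Suc.IH sum.atMost_Suc by (simp only: right_diff_distrib distrib_left power_Suc mult_1_right mult.assoc)
qed

lemma total_degree_ge:
  assumes "coeff2 p a b \<noteq> 0"
  shows "a + b \<le> total_degree p"
proof -
  have "a + b \<in> (\<lambda>(a, b). a + b) ` monomials2 p"
    using assms by (force simp: monomials2_def)
  moreover have "p \<noteq> 0"
    using assms by (auto simp: coeff2_def)
  ultimately show ?thesis
    by (simp add: total_degree_def)
qed

lemma total_degree_attained:
  assumes "p \<noteq> 0"
  obtains a b where "a + b = total_degree p" "coeff2 p a b \<noteq> 0"
proof -
  from assms have "coeff (lead_coeff p) (degree (lead_coeff p)) \<noteq> 0"
    by simp
  then have "(degree (lead_coeff p), degree p) \<in> monomials2 p"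
    by (simp add: monomials2_def coeff2_def)
  then have "monomials2 p \<noteq> {}"
    by blast
  then have "total_degree p \<in> (\<lambda>(a, b). a + b) ` monomials2 p"
    using assms Max_in [of "(\<lambda>(a, b). a + b) ` monomials2 p"] by (simp add: total_degree_def)
  then show ?thesis
    using that by (auto simp: monomials2_def)
qed

text \<open>By homogeneity each summand is the degree \<open>j\<close> part of \<open>p\<close> at
  the point of the line x + y = 1 with x / y = \<open>t\<close>.\<close>

lemma sum_form_eq_eval2:
  assumes "t \<ge> 0"
  shows "(\<Sum>j\<le>total_degree p. poly (form p j) t / (1 + t) ^ j) = eval2 p (t / (1 + t)) (1 / (1 + t))"
proof -
  let ?d = "total_degree p"
  define g where "g a b = coeff2 p a b * (t / (1 + t)) ^ a * (1 / (1 + t)) ^ b" for a b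
  have "poly (form p j) t / (1 + t) ^ j = (\<Sum>a\<le>j. g a (j - a))" for j
    unfolding form_def poly_sum sum_divide_distrib g_def using assms
    by (intro sum.cong) (auto simp: poly_monom power_divide power_add [symmetric])
  then have "(\<Sum>j\<le>?d. poly (form p j) t / (1 + t) ^ j) = (\<Sum>(a, b)\<in>{(a, b). a + b \<le> ?d}. g a b)"
    by (simp add: sum.triangle_reindex_eq)
  also have "\<dots> = (\<Sum>(a, b)\<in>monomials2 p. g a b)"
  proof (rule sum.mono_neutral_right)
    show "finite {(a, b). a + b \<le> ?d}"
      by (rule finite_subset [of _ "{..?d} \<times> {..?d}"]) auto
  qed (auto simp: monomials2_def g_def intro: total_degree_ge)
  finally show ?thesis
    by (simp add: eval2_eq_sum_monomials2 g_def)
qed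

text \<open>The sum of all parts of \<open>p\<close> is 1 on the line, so this form vanishes at
  every \<open>t \<ge> 0\<close>; a polynomial with infinitely many roots is zero.\<close>

lemma quotient_form_total_degree_eq_0:
  assumes "\<And>x y. x + y = 1 \<Longrightarrow> eval2 p x y = 1"
  shows "quotient_form p (total_degree p) = 0"
proof -
  have "poly (quotient_form p (total_degree p)) t = 0" if "t \<ge> 0" for t
  proof -
    have "t / (1 + t) + 1 / (1 + t) = 1"
      using that by (simp add: field_simps)
    with assms that show ?thesis
      by (simp add: poly_quotient_form sum_form_eq_eval2)
  qed
  then have "{0..} \<subseteq> {t. poly (quotient_form p (total_degree p)) t = 0}"
    by auto
  then have "infinite {t. poly (quotient_form p (total_degree p)) t = 0}"
    using infinite_Ici infinite_super by blast
  then show ?thesis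
    using poly_roots_finite by blast
qed

theorem lemma3p3:
  fixes d :: nat and f :: "real poly poly"
  assumes "d > 1" and "odd d"
    and "f \<in> H2 d" and "sharp d f"
  shows "\<exists>a b. a + b = d - 1 \<and> coeff2 f a b \<noteq> 0"
proof (rule ccontr)
  assume "\<not> ?thesis"
  then have gap: "coeff2 f a b = 0" if "a + b = d - 1" for a b
    using that by blast
  have deg: "total_degree f = d" and nonneg: "\<And>a b. coeff2 f a b \<ge> 0"
    and one: "\<And>x y. x + y = 1 \<Longrightarrow> eval2 f x y = 1"
    using \<open>f \<in> H2 d\<close> by (auto simp: H2_def)
  have "f \<noteq> 0"
    using deg \<open>d > 1\<close> by (auto simp: total_degree_def)
  have "d + 5 \<le> 2 * card {(a, b). coeff2 f a b \<noteq> 0}"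
  proof (rule card_support_ge [where q = "\<lambda>k. coeff (quotient_form f k)"])
    show "\<exists>a\<le>d. coeff2 f a (d - a) \<noteq> 0"
      using total_degree_attained [OF \<open>f \<noteq> 0\<close>] deg by (metis diff_add_inverse le_add1)
    show "coeff (quotient_form f d) i = 0" for i
      using quotient_form_total_degree_eq_0 [OF one] deg by simp
    show "finite {(a, b). coeff2 f a b \<noteq> 0}"
      using finite_monomials2 [of f] by (simp add: monomials2_def)
  qed (use assms nonneg gap in \<open>auto simp: coeff_form coeff_quotient_form_eq_0\<close>)
  then have "d + 5 \<le> 2 * num_monomials f"
    by (simp add: num_monomials_def monomials2_def)
  moreover obtain p where "p \<in> H2 d" "2 * num_monomials p \<le> d + 3"
    using exists_H2_few_monomials [OF \<open>odd d\<close>] by blast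
  moreover have "num_monomials f \<le> num_monomials p"
    using \<open>sharp d f\<close> \<open>p \<in> H2 d\<close> by (simp add: sharp_def)
  ultimately show False by linarith
qed

end
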